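(* Let $n\ge 1$ and let $S=(s_1,s_2,\dots,s_n)$ be an $n$-tuple of integers such that $0\le s_1\le s_2\le\dots\le s_n$, $\sum_{i=1}^k s_i\ge\binom{k}{2}$ for all $1\le k\le n$, and $\sum_{i=1}^n s_i=\binom{n}{2}$. Then $S$ is the score sequence of some $n$-tournament.
   Context: An $n$-tournament is an orientation of the complete graph on $n$ vertices. The score of a vertex is its out-degree. The score sequence of an $n$-tournament is the $n$-tuple of the scores of its vertices arranged in non-decreasing order. *)

theory Defs
  imports "Graph_Theory.Kuratowski" "HOL-Library.Multiset"
begin

text \<open>
  Undirected graphs are symmetric digraphs here: an edge is a pair of opposite arcs, and an
  orientation keeps exactly one of the two.
\<close>

definition orientation :: "'a pair_pre_digraph \<Rightarrow> 'a pair_pre_digraph \<Rightarrow> bool" where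
  "orientation T G \<longleftrightarrow> spanning (with_proj T) (with_proj G) \<and>
     (\<forall>(u, v) \<in> parcs G. (u, v) \<in> parcs T \<longleftrightarrow> (v, u) \<notin> parcs T)"

definition tournament :: "nat \<Rightarrow> 'a pair_pre_digraph \<Rightarrow> bool" where
  "tournament n T \<longleftrightarrow> (\<exists>G. complete_digraph n (with_proj G) \<and> orientation T G)"

abbreviation score :: "'a pair_pre_digraph \<Rightarrow> 'a \<Rightarrow> nat" where
  "score T v \<equiv> out_degree (with_proj T) v"

definition score_sequence :: "'a pair_pre_digraph \<Rightarrow> nat list" where
  "score_sequence T = sorted_list_of_multiset {# score T v. v \<in># mset_set (pverts T) #}"

end

theory Submission
  imports Defs
begin

text \<open>
  Why Landau's conditions suffice: the transitive tournament on \<open>1, \<dots>, n\<close> has scores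
  \<open>0, 1, \<dots>, n - 1\<close>, whose partial sums are exactly the numbers \<open>k choose 2\<close>. The hypotheses
  therefore say that \<open>s\<close> is obtained from this score vector by moving weight from late vertices to
  early ones, and tournaments admit such moves one unit at a time. If the score of \<open>v\<close> is at least
  that of \<open>u\<close>, then there is a path of length at most two from \<open>v\<close> to \<open>u\<close>, and reversing it costs
  \<open>v\<close> one point, gives \<open>u\<close> one point, and changes no other score (\<open>score_transfer\<close>).

  Consider all tournaments whose partial score sums are bounded by those of \<open>s\<close>, with equal totals,
  and among them one that minimises the moment (the sum of all \<open>i\<close> times the score of \<open>i\<close>). If its
  scores differed from \<open>s\<close>, let \<open>v\<close> be the first vertex with too large a score. Some earlier \<open>u\<close>
  must have too small a score, and between \<open>u\<close> and \<open>v\<close> the bounds on the partial sums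
  are strict (\<open>prefix_dominated_transfer\<close>). As \<open>s\<close> is nondecreasing, the score of \<open>v\<close> exceeds that
  of \<open>u\<close>, so a point can be transferred from \<open>v\<close> to \<open>u\<close>. The bounds survive and the moment drops
  by \<open>v - u\<close>, which contradicts minimality.
\<close>

section \<open>Reversing arcs and paths in a tournament\<close>

text \<open>
  A bare relation, without a record of the underlying complete graph: reversing an arc then only
  changes a set of pairs.
\<close>

definition tournament_on :: "'a set \<Rightarrow> 'a rel \<Rightarrow> bool" where
  "tournament_on V E \<longleftrightarrow> E \<subseteq> V \<times> V \<and> irrefl E \<and>
     (\<forall>u\<in>V. \<forall>v\<in>V. u \<noteq> v \<longrightarrow> ((u, v) \<in> E \<longleftrightarrow> (v, u) \<notin> E))"

abbreviation outdeg :: "'a rel \<Rightarrow> 'a \<Rightarrow> nat" where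
  "outdeg E u \<equiv> card (E `` {u})"

lemma tournament_on_arcD:
  assumes "tournament_on V E" "(u, v) \<in> E"
  shows "u \<in> V" "v \<in> V" "u \<noteq> v" "(v, u) \<notin> E"
proof -
  show V: "u \<in> V" "v \<in> V" using assms unfolding tournament_on_def by blast+
  show ne: "u \<noteq> v" using assms unfolding tournament_on_def irrefl_def by blast
  show "(v, u) \<notin> E" using assms V ne unfolding tournament_on_def by blast
qed

lemma tournament_on_iff:
  assumes "tournament_on V E" "u \<in> V" "v \<in> V" "u \<noteq> v"
  shows "(u, v) \<in> E \<longleftrightarrow> (v, u) \<notin> E"
  using assms unfolding tournament_on_def by blast

lemma finite_successors:
  assumes "finite V" "tournament_on V E"
  shows "finite (E `` {u})"
proof (rule finite_subset)
  show "E `` {u} \<subseteq> V" using tournament_on_arcD(2)[OF assms(2)] by blast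
qed (rule assms(1))

lemma reverse_arc:
  assumes "finite V" "tournament_on V E" "(a, b) \<in> E"
  defines "E' \<equiv> insert (b, a) (E - {(a, b)})"
  shows "tournament_on V E'"
    and "int (outdeg E' x) = int (outdeg E x) + (if x = b then 1 else 0) - (if x = a then 1 else 0)"
proof -
  note ab = tournament_on_arcD[OF assms(2,3)]
  show "tournament_on V E'"
    unfolding tournament_on_def
  proof (intro conjI ballI impI)
    show "E' \<subseteq> V \<times> V" "irrefl E'"
      using tournament_on_arcD[OF assms(2)] ab by (fastforce simp: irrefl_def E'_def)+
    fix x y assume "x \<in> V" "y \<in> V" "x \<noteq> y"
    then have "(x, y) \<in> E \<longleftrightarrow> (y, x) \<notin> E"
      by (rule tournament_on_iff[OF assms(2)])
    then show "(x, y) \<in> E' \<longleftrightarrow> (y, x) \<notin> E'"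
      using ab unfolding E'_def by blast
  qed
  have fin: "finite (E `` {y})" for y
    using assms(1,2) by (rule finite_successors)
  consider "x = b" | "x = a" | "x \<noteq> a" "x \<noteq> b" by blast
  then show "int (outdeg E' x) =
      int (outdeg E x) + (if x = b then 1 else 0) - (if x = a then 1 else 0)"
  proof cases
    case 1
    then have "E' `` {x} = insert a (E `` {x})" using ab by (auto simp: E'_def)
    then show ?thesis using 1 ab fin by simp
  next
    case 2
    then have "E `` {x} = insert b (E' `` {x})" "b \<notin> E' `` {x}"
      using ab assms(3) by (auto simp: E'_def)
    moreover have "finite (E' `` {x})"
      using calculation(1) fin[of x] by simp
    ultimately show ?thesis using 2 ab by simp
  next
    case 3
    then have "E' `` {x} = E `` {x}" by (auto simp: E'_def)
    then show ?thesis using 3 by simp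
  qed
qed

text \<open>
  If \<open>v\<close> does not beat \<open>u\<close>, then \<open>u\<close> beats \<open>v\<close>; if moreover every vertex beaten by \<open>v\<close> were beaten
  by \<open>u\<close>, then \<open>u\<close> would have the strictly larger score. So \<open>v\<close> beats some \<open>w\<close> that beats \<open>u\<close>,
  and reversing both arcs leaves the score of \<open>w\<close> unchanged.
\<close>

lemma score_transfer:
  assumes "finite V" "tournament_on V E" "u \<in> V" "v \<in> V" "u \<noteq> v" "outdeg E u \<le> outdeg E v"
  shows "\<exists>E'. tournament_on V E' \<and> (\<forall>x. int (outdeg E' x) =
           int (outdeg E x) + (if x = u then 1 else 0) - (if x = v then 1 else 0))"
proof (cases "(v, u) \<in> E")
  case True
  note E' = reverse_arc[OF assms(1,2) True]
  show ?thesis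
    by (intro exI[of _ "insert (u, v) (E - {(v, u)})"] conjI allI, rule E'(1)) (rule E'(2))
next
  case False
  then have uv: "(u, v) \<in> E"
    using tournament_on_iff[OF assms(2-5)] by blast
  have "\<not> E `` {v} \<subseteq> E `` {u}"
  proof
    assume sub: "E `` {v} \<subseteq> E `` {u}"
    have "v \<notin> E `` {v}" using tournament_on_arcD(3)[OF assms(2)] by blast
    then have "E `` {v} \<subset> E `` {u}" using sub uv by blast
    then have "outdeg E v < outdeg E u"
      using finite_successors[OF assms(1,2)] by (rule psubset_card_mono[rotated])
    then show False using assms(6) by simp
  qed
  then obtain w where vw: "(v, w) \<in> E" and "(u, w) \<notin> E" by blast
  moreover have "w \<noteq> u" using vw False by blast
  moreover have "w \<in> V" using tournament_on_arcD(2)[OF assms(2) vw] .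
  ultimately have wu: "(w, u) \<in> E"
    using tournament_on_iff[OF assms(2), of w u] assms(3) by blast
  define E1 where "E1 = insert (w, v) (E - {(v, w)})"
  have E1: "tournament_on V E1"
    "int (outdeg E1 x) = int (outdeg E x) + (if x = w then 1 else 0) - (if x = v then 1 else 0)"
    for x using reverse_arc[OF assms(1,2) vw] by (auto simp: E1_def)
  have "(w, u) \<in> E1" using wu assms(5) by (auto simp: E1_def)
  note E2 = reverse_arc[OF assms(1) E1(1) this]
  show ?thesis
    by (intro exI[of _ "insert (u, w) (E1 - {(w, u)})"] conjI allI, rule E2(1)) (simp add: E2(2) E1(2))
qed

section \<open>Existence by minimising the moment\<close>

text \<open>
  \<open>v\<close> is the first index at which \<open>d\<close> is too large. Up to there \<open>d\<close> never exceeds \<open>s\<close>, so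
  a single index \<open>u\<close> with \<open>d u < s u\<close> makes every partial sum from \<open>u\<close> to \<open>v - 1\<close> strictly smaller;
  such a \<open>u\<close> exists because the partial sums up to \<open>v\<close> would otherwise be in the wrong order.
\<close>

lemma prefix_dominated_transfer:
  fixes d s :: "nat \<Rightarrow> int"
  assumes le: "\<And>k. k \<le> n \<Longrightarrow> (\<Sum>i = 1..k. d i) \<le> (\<Sum>i = 1..k. s i)"
    and total: "(\<Sum>i = 1..n. d i) = (\<Sum>i = 1..n. s i)"
    and ne: "\<exists>i\<in>{1..n}. d i \<noteq> s i"
  shows "\<exists>u v. 1 \<le> u \<and> u < v \<and> v \<le> n \<and> d u < s u \<and> s v < d v \<and>
           (\<forall>k. u \<le> k \<longrightarrow> k < v \<longrightarrow> (\<Sum>i = 1..k. d i) < (\<Sum>i = 1..k. s i))"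
proof -
  have "\<exists>v. v \<in> {1..n} \<and> s v < d v"
  proof (rule ccontr)
    assume "\<nexists>v. v \<in> {1..n} \<and> s v < d v"
    then have "\<forall>i\<in>{1..n}. d i \<le> s i" by force
    moreover have "\<exists>i\<in>{1..n}. d i < s i" using ne calculation by force
    ultimately have "(\<Sum>i = 1..n. d i) < (\<Sum>i = 1..n. s i)"
      by (intro sum_strict_mono_ex1) auto
    then show False using total by simp
  qed
  then obtain v where v: "v \<in> {1..n}" "s v < d v"
    and least: "\<And>i. i < v \<Longrightarrow> \<not> (i \<in> {1..n} \<and> s i < d i)"
    using exists_least_iff[of "\<lambda>v. v \<in> {1..n} \<and> s v < d v"] by blast
  have before: "d i \<le> s i" if "1 \<le> i" "i < v" for i
    using least[of i] v(1) that by auto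
  have "\<exists>u. 1 \<le> u \<and> u < v \<and> d u < s u"
  proof (rule ccontr)
    assume "\<nexists>u. 1 \<le> u \<and> u < v \<and> d u < s u"
    then have "(\<Sum>i\<in>{1..<v}. s i) \<le> (\<Sum>i\<in>{1..<v}. d i)" by (intro sum_mono) force
    moreover have "{1..v} = insert v {1..<v}" using v(1) by auto
    ultimately have "(\<Sum>i = 1..v. s i) < (\<Sum>i = 1..v. d i)" using v(2) by simp
    then show False using le[of v] v(1) by simp
  qed
  then obtain u where u: "1 \<le> u" "u < v" "d u < s u" by blast
  have "(\<Sum>i = 1..k. d i) < (\<Sum>i = 1..k. s i)" if "u \<le> k" "k < v" for k
    using that u before by (intro sum_strict_mono_ex1) force+
  then show ?thesis using u v by (intro exI[of _ u] exI[of _ v]) auto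
qed

lemma sum_predecessors: "(\<Sum>i = 1..k. int (i - 1)) = int (k choose 2)"
  by (induction k) (simp_all add: numeral_2_eq_2)

lemma transitive_tournament:
  fixes n :: nat
  defines "E \<equiv> {(i, j). i \<in> {1..n} \<and> j \<in> {1..<i}}"
  shows "tournament_on {1..n} E" and "i \<in> {1..n} \<Longrightarrow> outdeg E i = i - 1"
proof -
  show "tournament_on {1..n} E"
    by (auto simp: tournament_on_def irrefl_def E_def)
  show "outdeg E i = i - 1" if "i \<in> {1..n}"
  proof -
    have "E `` {i} = {1..<i}" using that by (auto simp: E_def)
    then show ?thesis by simp
  qed
qed

text \<open>
  In a minimiser of the moment the scores are exactly \<open>s\<close>, since any discrepancy permits a transfer
  to an earlier vertex. The transitive tournament makes the set of candidates nonempty.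
\<close>

lemma tournament_with_scores:
  fixes s :: "nat \<Rightarrow> int"
  assumes mono: "\<And>i j. 1 \<le> i \<Longrightarrow> i \<le> j \<Longrightarrow> j \<le> n \<Longrightarrow> s i \<le> s j"
    and prefix: "\<And>k. k \<le> n \<Longrightarrow> int (k choose 2) \<le> (\<Sum>i = 1..k. s i)"
    and total: "(\<Sum>i = 1..n. s i) = int (n choose 2)"
  shows "\<exists>E. tournament_on {1..n} E \<and> (\<forall>i\<in>{1..n}. int (outdeg E i) = s i)"
proof -
  define feasible where "feasible E \<longleftrightarrow> tournament_on {1..n} E \<and>
      (\<forall>k\<le>n. (\<Sum>i = 1..k. int (outdeg E i)) \<le> (\<Sum>i = 1..k. s i)) \<and>
      (\<Sum>i = 1..n. int (outdeg E i)) = (\<Sum>i = 1..n. s i)" for E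
  define moment where "moment E = (\<Sum>i = 1..n. i * outdeg E i)" for E :: "nat rel"
  define E0 where "E0 = {(i, j). i \<in> {1..n} \<and> j \<in> {1..<i}}"
  have "(\<Sum>i = 1..k. int (outdeg E0 i)) = int (k choose 2)" if "k \<le> n" for k
  proof -
    have "(\<Sum>i = 1..k. int (outdeg E0 i)) = (\<Sum>i = 1..k. int (i - 1))"
      using that transitive_tournament(2)[of _ n] by (intro sum.cong) (auto simp: E0_def)
    then show ?thesis by (simp only: sum_predecessors)
  qed
  then have "feasible E0"
    using transitive_tournament(1)[of n] prefix total by (simp add: feasible_def E0_def)
  then obtain E where E: "feasible E" and minimal: "\<And>F. feasible F \<Longrightarrow> moment E \<le> moment F"
    using ex_has_least_nat[of feasible E0 moment] by blast
  have "\<forall>i\<in>{1..n}. int (outdeg E i) = s i"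
  proof (rule ccontr)
    assume "\<not> (\<forall>i\<in>{1..n}. int (outdeg E i) = s i)"
    then have "\<exists>i\<in>{1..n}. int (outdeg E i) \<noteq> s i" by blast
    then obtain u v where uv: "1 \<le> u" "u < v" "v \<le> n"
        "int (outdeg E u) < s u" "s v < int (outdeg E v)"
      and slack: "\<And>k. u \<le> k \<Longrightarrow> k < v \<Longrightarrow> (\<Sum>i = 1..k. int (outdeg E i)) < (\<Sum>i = 1..k. s i)"
      using prefix_dominated_transfer[of n "\<lambda>i. int (outdeg E i)" s] E
      unfolding feasible_def by blast
    \<comment> \<open>Monotonicity of \<open>s\<close> puts \<open>s u \<le> s v\<close> between the two scores.\<close>
    have "outdeg E u \<le> outdeg E v" using mono[of u v] uv by linarith
    then obtain F where F: "tournament_on {1..n} F"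
      and deg: "\<And>x. int (outdeg F x) =
        int (outdeg E x) + (if x = u then 1 else 0) - (if x = v then 1 else 0)"
      using score_transfer[of "{1..n}" E u v] E uv by (auto simp: feasible_def)
    have sums: "(\<Sum>i = 1..k. int (outdeg F i)) = (\<Sum>i = 1..k. int (outdeg E i))
        + (if u \<le> k then 1 else 0) - (if v \<le> k then 1 else 0)" for k
      using uv by (simp add: deg sum.distrib sum_subtractf)
    \<comment> \<open>Only the partial sums from \<open>u\<close> to \<open>v - 1\<close> grow, by one, and those had slack.\<close>
    have "feasible F"
      unfolding feasible_def
    proof (intro conjI allI impI)
      fix k assume "k \<le> n"
      then have "(\<Sum>i = 1..k. int (outdeg E i)) \<le> (\<Sum>i = 1..k. s i)"
        using E by (simp add: feasible_def)
      then show "(\<Sum>i = 1..k. int (outdeg F i)) \<le> (\<Sum>i = 1..k. s i)"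
        using slack[of k] uv unfolding sums by (auto split: if_splits)
    next
      show "(\<Sum>i = 1..n. int (outdeg F i)) = (\<Sum>i = 1..n. s i)"
        using E uv unfolding sums by (simp add: feasible_def)
    qed (rule F)
    moreover have "int (moment F) = int (moment E) + int u - int v"
    proof -
      have "int (moment F) = (\<Sum>i = 1..n. int i * int (outdeg E i)
          + (if i = u then int i else 0) - (if i = v then int i else 0))"
        unfolding moment_def of_nat_sum of_nat_mult deg
        by (intro sum.cong) (auto simp: algebra_simps)
      then show ?thesis using uv by (simp add: moment_def sum.distrib sum_subtractf)
    qed
    ultimately show False using minimal[of F] uv by linarith
  qed
  then show ?thesis using E by (auto simp: feasible_def)
qed

section \<open>Orientations and score sequences\<close>

lemma tournament_of_tournament_on:
  assumes "finite V" "tournament_on V E"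
  shows "tournament (card V) \<lparr> pverts = V, parcs = E \<rparr>"
proof -
  define A where "A = {(u, v). (u, v) \<in> V \<times> V \<and> u \<noteq> v}"
  define G where "G = \<lparr> pverts = V, parcs = A \<rparr>"
  have sub: "E \<subseteq> A"
    using tournament_on_arcD[OF assms(2)] unfolding A_def by blast
  have anti: "\<forall>(u, v)\<in>A. (u, v) \<in> E \<longleftrightarrow> (v, u) \<notin> E"
    using tournament_on_iff[OF assms(2)] unfolding A_def by blast
  have "finite A" by (rule finite_subset[of _ "V \<times> V"]) (use assms(1) in \<open>auto simp: A_def\<close>)
  then have "pair_graph G"
    using assms(1) by unfold_locales (auto simp: G_def A_def symmetric_def sym_def)
  then interpret pair_graph G .
  have "graph (with_proj G)" by unfold_locales
  then have "complete_digraph (card V) (with_proj G)"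
    by (auto simp: complete_digraph_def G_def A_def)
  moreover have "wf_digraph (with_proj \<lparr> pverts = V, parcs = E \<rparr>)"
    by unfold_locales (use sub in \<open>auto simp: A_def\<close>)
  then have "orientation \<lparr> pverts = V, parcs = E \<rparr> G"
    unfolding orientation_def spanning_def subgraph_def compatible_def
    using sub anti wf_digraph unfolding G_def with_proj_simps by simp
  ultimately show ?thesis unfolding tournament_def by blast
qed

lemma score_eq_outdeg: "score \<lparr> pverts = V, parcs = E \<rparr> u = outdeg E u"
proof -
  have "out_arcs (with_proj \<lparr> pverts = V, parcs = E \<rparr>) u = Pair u ` (E `` {u})"
    by (auto simp: out_arcs_def)
  then show ?thesis by (simp add: out_degree_def card_image inj_on_def)
qed

lemma score_sequence_of_sorted:
  assumes "distinct vs" "pverts T = set vs" "sorted (map (score T) vs)"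
  shows "score_sequence T = map (score T) vs"
  unfolding score_sequence_def assms(2) mset_set_set[OF assms(1)] mset_map[symmetric]
    sorted_list_of_multiset_mset
  using assms(3) by (rule sorted_sort_id)

theorem theorem11:
  fixes n :: nat and s :: "nat \<Rightarrow> int"
  assumes "n \<ge> 1"
    and "0 \<le> s 1"
    and "\<And>i. 1 \<le> i \<Longrightarrow> i < n \<Longrightarrow> s i \<le> s (i + 1)"
    and "\<And>k. 1 \<le> k \<Longrightarrow> k \<le> n \<Longrightarrow> (\<Sum>i = 1..k. s i) \<ge> int (k choose 2)"
    and "(\<Sum>i = 1..n. s i) = int (n choose 2)"
  shows "\<exists>T :: nat pair_pre_digraph. tournament n T \<and>
           map int (score_sequence T) = map s [1..<n + 1]"
proof -
  have mono: "s i \<le> s j" if "1 \<le> i" "i \<le> j" "j \<le> n" for i j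
    using that(2,3)
  proof (induction j rule: dec_induct)
    case (step k)
    then show ?case using assms(3)[of k] that(1) by simp
  qed simp
  have prefix: "int (k choose 2) \<le> (\<Sum>i = 1..k. s i)" if "k \<le> n" for k
    using assms(4)[of k] that by (cases "k = 0") auto
  obtain E where E: "tournament_on {1..n} E" and deg: "\<And>i. i \<in> {1..n} \<Longrightarrow> int (outdeg E i) = s i"
    using tournament_with_scores[OF mono prefix assms(5)] by blast
  define T where "T = \<lparr> pverts = {1..n}, parcs = E \<rparr>"
  have T: "tournament n T"
    using tournament_of_tournament_on[OF _ E] by (simp add: T_def)
  have score: "int (score T i) = s i" if "i \<in> {1..n}" for i
    using deg[OF that] by (simp add: T_def score_eq_outdeg)
  have "sorted (map (score T) [1..<n + 1])"
    unfolding sorted_map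
  proof (rule sorted_wrt_mono_rel)
    show "sorted_wrt (\<le>) [1..<n + 1]" by (rule sorted_upt)
    fix i j assume "i \<in> set [1..<n + 1]" "j \<in> set [1..<n + 1]" "i \<le> j"
    then have "int (score T i) \<le> int (score T j)"
      using score[of i] score[of j] mono[of i j] unfolding set_upt atLeastLessThan_iff atLeastAtMost_iff
      by linarith
    then show "score T i \<le> score T j" by simp
  qed
  moreover have "pverts T = set [1..<n + 1]" by (auto simp: T_def)
  ultimately have "score_sequence T = map (score T) [1..<n + 1]"
    by (intro score_sequence_of_sorted) auto
  then have "map int (score_sequence T) = map s [1..<n + 1]"
    using score by (simp del: upt_Suc)
  then show ?thesis using T by blast
qed

end
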